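(* Let $P(z)\in\mathbb{Q}[z]$ be a nonzero polynomial with $P(0)=P(1)=0$, let $N=\deg P\ (\ge 2)$, and let $L\ge 1$ be an integer. Let $\alpha(X)\in\mathbb{C}[[X]]$ be a convergent power series satisfying $\alpha(0)=0$ and $$1-x^{N}P(z)=\prod_{m=1}^{N}\bigl(1-\alpha(\epsilon_{N}^{m}x)\,z\bigr)$$ in a neighborhood of $x=0$. Then $$\frac{1}{1+(\psi_{P})^{\circ_{\hbar}L}X^{NL}}=\exp_{\ast_{\hbar}}\left(-\sum_{k\ge 2}\frac{\hbar^{-k}}{k!}\,\phi_{k}\sum_{m=1}^{NL}\bigl(\mathrm{Log}(1-\alpha(\epsilon_{NL}^{m}X))\bigr)^{k}\right)$$ as formal power series in $X$.
   Context: Notation. $\epsilon_{M}=\exp(2\pi i/M)$ for $M\ge1$. $\mathcal{C}=\mathbb{Q}[\hbar,\hbar^{-1}]$. $\widehat{\mathfrak{H}^{1}}=\mathcal{C}\langle e_{1},g_{1},g_{2},g_{3},\ldots\rangle$ is the non-commutative polynomial ring over $\mathcal{C}$ (concatenation product). $\mathcal{A}=\{e_{1}-g_{1}\}\sqcup\{g_{k}\mid k\ge1\}$ freely generates it, and $\mathfrak{z}$ is the free $\mathcal{C}$-module spanned by $\mathcal{A}$. The symmetric (associative) $\mathcal{C}$-bilinear map $\circ_{\hbar}:\mathfrak{z}\times\mathfrak{z}\to\mathfrak{z}$ is given by $(e_{1}-g_{1})\circ_{\hbar}(e_{1}-g_{1})=\hbar(e_{1}-g_{1})$, $(e_{1}-g_{1})\circ_{\hbar}g_{k}=\hbar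 g_{k}$, $g_{k}\circ_{\hbar}g_{l}=g_{k+l}$ $(k,l\ge1)$. Write $u^{\circ_{\hbar}1}=u$, $u^{\circ_{\hbar}n}=u^{\circ_{\hbar}(n-1)}\circ_{\hbar}u$. The harmonic product $\ast_{\hbar}$ on $\widehat{\mathfrak{H}^{1}}$ is the (commutative, associative) $\mathcal{C}$-bilinear product determined by $w\ast_{\hbar}1=1\ast_{\hbar}w=w$ and $(wu)\ast_{\hbar}(w'v)=(w\ast_{\hbar}w'v)u+(wu\ast_{\hbar}w')v+(w\ast_{\hbar}w')(u\circ_{\hbar}v)$ for $w,w'\in\widehat{\mathfrak{H}^{1}}$, $u,v\in\mathcal{A}$. All these operations are extended to power series in the central variable $X$ in the obvious coefficientwise way, and, where needed (to make sense of the complex coefficients of $\alpha$), from $\mathcal{C}$ to $\mathbb{C}[\hbar,\hbar^{-1}]$. For $f(X)$ in $X\widehat{\mathfrak{H}^{1}}[[X]]$, $\exp_{\ast_{\hbar}}(f)=1+\sum_{n\ge1}\frac{1}{n!}f^{\ast_{\hbar}n}$, where $f^{\ast_\hbar n}$ is the $n$-th power for $\ast_\hbar$; $\frac{1}{1+f(X)}=\sum_{n\ge0}(-f(X))^{n}$ is the inverse with respect to concatenation. For $P(z)=\sum_{j=1}^{N}c_{j}z^{j}$ put $\psi_{P}=\sum_{j=1}^{N}c_{j}(-\hbar)^{-j}g_{j}\in\mathfrak{z}$. For $k\ge1$, $\phi_{k}=\sum_{j=1}^{k}(j-1)!\,{k\brace j}\,\hbar^{k-j}g_{j}$, where ${k\brace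 j}$ is the Stirling number of the second kind. $\mathrm{Log}(1-\alpha(\cdot))$ is the power series obtained from $\mathrm{Log}(1-T)=-\sum_{n\ge1}T^{n}/n$. (A power series $\alpha$ as in the statement always exists.) *)

theory Defs
  imports "HOL-Analysis.Analysis" "HOL-Combinatorics.Stirling" "HOL-Library.Poly_Mapping"
begin

(* The free monoid: with this instance, poly_mapping provides the free associative
   algebra as the monoid algebra over words, its product being concatenation. *)
instantiation list :: (type) monoid_add
begin

definition zero_list :: "'a list" where "zero_list = []"

definition plus_list :: "'a list \<Rightarrow> 'a list \<Rightarrow> 'a list" where "plus_list = (@)"

instance
  by standard (simp_all add: zero_list_def plus_list_def)

end

text \<open>
  Laurent polynomials in \<open>\<hbar>\<close>. The coefficient field is \<open>\<complex>\<close> rather than \<open>\<rat>\<close>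
  because the coefficients of \<open>\<alpha>\<close> are complex; \<open>\<rat>[\<hbar>, \<hbar>\<^sup>-\<^sup>1]\<close> is a subring.
\<close>
type_synonym laurent = "int \<Rightarrow>\<^sub>0 complex"

definition laurent_const :: "complex \<Rightarrow> laurent"
  where "laurent_const c = Poly_Mapping.single 0 c"

definition hbar_pow :: "int \<Rightarrow> laurent"
  where "hbar_pow k = Poly_Mapping.single k 1"

abbreviation hbar :: laurent
  where "hbar \<equiv> hbar_pow 1"

lemma hbar_pow_0: "hbar_pow 0 = 1"
  by (simp add: hbar_pow_def)

lemma hbar_pow_add: "hbar_pow (k + l) = hbar_pow k * hbar_pow l"
  by (simp add: hbar_pow_def mult_single)

lemma minus_hbar_power_inverse: "(- hbar) ^ j * ((- 1) ^ j * hbar_pow (- int j)) = 1"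
proof (induction j)
  case (Suc j)
  have "hbar_pow (- int j) = hbar * hbar_pow (- int (Suc j))"
    by (simp add: hbar_pow_def mult_single)
  with Suc show ?case by (simp add: algebra_simps)
qed (simp add: hbar_pow_0)

text \<open>
  The alphabet: \<open>LetterE\<close> is the letter \<open>e\<^sub>1 - g\<^sub>1\<close>, and \<open>LetterG n\<close> is \<open>g\<close> with index \<open>n + 1\<close>,
  so that the indices range over the positive integers. The original generator \<open>e\<^sub>1\<close> is
  the sum of the letters \<open>LetterE\<close> and \<open>LetterG 0\<close>.
\<close>
datatype letter = LetterE | LetterG nat

text \<open>The free module spanned by the alphabet, and the free algebra generated by it.\<close>
type_synonym zmod = "letter \<Rightarrow>\<^sub>0 laurent"
type_synonym H1 = "letter list \<Rightarrow>\<^sub>0 laurent"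

definition lscale :: "laurent \<Rightarrow> ('a \<Rightarrow>\<^sub>0 laurent) \<Rightarrow> ('a \<Rightarrow>\<^sub>0 laurent)"
  where "lscale c x = Poly_Mapping.map ((*) c) x"

lemma lookup_lscale: "Poly_Mapping.lookup (lscale c x) a = c * Poly_Mapping.lookup x a"
  by (simp add: lscale_def map.rep_eq when_def)

definition linear_ext :: "('a \<Rightarrow> 'b \<Rightarrow>\<^sub>0 laurent) \<Rightarrow> ('a \<Rightarrow>\<^sub>0 laurent) \<Rightarrow> ('b \<Rightarrow>\<^sub>0 laurent)"
  where "linear_ext f x = (\<Sum>a\<in>Poly_Mapping.keys x. lscale (Poly_Mapping.lookup x a) (f a))"

definition bilinear_ext ::
    "('a \<Rightarrow> 'b \<Rightarrow> 'c \<Rightarrow>\<^sub>0 laurent) \<Rightarrow> ('a \<Rightarrow>\<^sub>0 laurent) \<Rightarrow> ('b \<Rightarrow>\<^sub>0 laurent) \<Rightarrow> ('c \<Rightarrow>\<^sub>0 laurent)"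
  where "bilinear_ext f x y =
    (\<Sum>a\<in>Poly_Mapping.keys x. \<Sum>b\<in>Poly_Mapping.keys y.
       lscale (Poly_Mapping.lookup x a * Poly_Mapping.lookup y b) (f a b))"

definition zmod_to_H1 :: "zmod \<Rightarrow> H1"
  where "zmod_to_H1 = linear_ext (\<lambda>a. Poly_Mapping.single [a] 1)"

(* Only meant for k \<ge> 1. *)
definition gen :: "nat \<Rightarrow> zmod"
  where "gen k = Poly_Mapping.single (LetterG (k - 1)) 1"

(* The index in the last case: (m + 1) + (n + 1) = (m + n + 1) + 1. *)
fun circ_letter :: "letter \<Rightarrow> letter \<Rightarrow> zmod" where
  "circ_letter LetterE LetterE = Poly_Mapping.single LetterE hbar"
| "circ_letter LetterE (LetterG n) = Poly_Mapping.single (LetterG n) hbar"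
| "circ_letter (LetterG m) LetterE = Poly_Mapping.single (LetterG m) hbar"
| "circ_letter (LetterG m) (LetterG n) = Poly_Mapping.single (LetterG (m + n + 1)) 1"

definition circ :: "zmod \<Rightarrow> zmod \<Rightarrow> zmod"
  where "circ = bilinear_ext circ_letter"

(* Only meant for n \<ge> 1. *)
definition circ_pow :: "zmod \<Rightarrow> nat \<Rightarrow> zmod"
  where "circ_pow u n = ((\<lambda>v. circ v u) ^^ (n - 1)) u"

text \<open>
  The harmonic product of two words. The recursion removes the last letters, so it is
  written with \<^const>\<open>butlast\<close> and \<^const>\<open>last\<close>; \<open>*\<close> is concatenation.
  The recursion equations in their usual shape are derived below.
\<close>
function harm_word :: "letter list \<Rightarrow> letter list \<Rightarrow> H1" where
  "harm_word x y =
    (if x = [] then Poly_Mapping.single y 1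
     else if y = [] then Poly_Mapping.single x 1
     else harm_word (butlast x) y * Poly_Mapping.single [last x] 1
        + harm_word x (butlast y) * Poly_Mapping.single [last y] 1
        + harm_word (butlast x) (butlast y) * zmod_to_H1 (circ_letter (last x) (last y)))"
  by auto
termination
  by (relation "Wellfounded.measure (\<lambda>(x, y). length x + length y)")
    (auto simp flip: length_greater_0_conv)

declare harm_word.simps [simp del]

lemma harm_word_Nil_left: "harm_word [] y = Poly_Mapping.single y 1"
  by (simp add: harm_word.simps)

lemma harm_word_Nil_right: "harm_word x [] = Poly_Mapping.single x 1"
  by (simp add: harm_word.simps)

lemma harm_word_snoc_snoc:
  "harm_word (x @ [u]) (y @ [v]) =
     harm_word x (y @ [v]) * Poly_Mapping.single [u] 1
   + harm_word (x @ [u]) y * Poly_Mapping.single [v] 1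
   + harm_word x y * zmod_to_H1 (circ_letter u v)"
  by (subst harm_word.simps) simp

definition harm :: "H1 \<Rightarrow> H1 \<Rightarrow> H1"
  where "harm = bilinear_ext harm_word"

text \<open>
  Power series over \<^typ>\<open>H1\<close>. The product of \<^typ>\<open>H1 fps\<close> is the coefficientwise
  extension of concatenation with central \<open>X\<close>, and infinite sums are taken in the
  \<open>X\<close>-adic topology that the library puts on formal power series; \<^const>\<open>suminf\<close> is
  written out because its binder syntax collides with that of \<^const>\<open>Sum_any\<close>.
\<close>
definition const_H1 :: "laurent \<Rightarrow> H1"
  where "const_H1 c = Poly_Mapping.single [] c"

definition fps_to_H1 :: "complex fps \<Rightarrow> H1 fps"
  where "fps_to_H1 F = Abs_fps (\<lambda>n. const_H1 (laurent_const (fps_nth F n)))"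

definition recip_one_plus :: "H1 fps \<Rightarrow> H1 fps"
  where "recip_one_plus f = suminf (\<lambda>n. (- f) ^ n)"

definition fps_harm :: "H1 fps \<Rightarrow> H1 fps \<Rightarrow> H1 fps"
  where "fps_harm F F' = Abs_fps (\<lambda>n. \<Sum>i\<le>n. harm (fps_nth F i) (fps_nth F' (n - i)))"

primrec fps_harm_pow :: "H1 fps \<Rightarrow> nat \<Rightarrow> H1 fps" where
  "fps_harm_pow f 0 = 1"
| "fps_harm_pow f (Suc n) = fps_harm (fps_harm_pow f n) f"

definition exp_harm :: "H1 fps \<Rightarrow> H1 fps"
  where "exp_harm f =
    1 + suminf (\<lambda>n. fps_const (const_H1 (laurent_const (1 / fact (Suc n)))) * fps_harm_pow f (Suc n))"

definition eps :: "nat \<Rightarrow> complex"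
  where "eps M = exp (2 * of_real pi * \<i> / of_nat M)"

text \<open>\<open>Log (1 - T)\<close> as a power series in \<open>T\<close>.\<close>
definition fps_log_one_minus :: "complex fps"
  where "fps_log_one_minus = Abs_fps (\<lambda>n. if n = 0 then 0 else - 1 / of_nat n)"

(* The coefficient of gen j is the coefficient of z ^ j in P times (-hbar) ^ (-j). *)
definition psi :: "rat poly \<Rightarrow> zmod"
  where "psi P = (\<Sum>j=1..degree P.
    lscale (laurent_const (of_rat (coeff P j)) * ((- 1) ^ j * hbar_pow (- int j))) (gen j))"

definition phi :: "nat \<Rightarrow> zmod"
  where "phi k = (\<Sum>j=1..k.
    lscale (of_nat (fact (j - 1) * Stirling k j) * hbar_pow (int (k - j))) (gen j))"

end

theory Submission
  imports Defs
begin

text \<open>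
  Right multiplications by letters commute for the harmonic product. Hence the Euler operator
  \<open>X d/dX\<close> acts on harmonic powers of a series \<open>f\<close> of letters by the usual rule, and the
  harmonic exponential of \<open>f\<close> is the only series \<open>W\<close> with constant term 1 and
  \<open>X W' = W * X f'\<close>. For \<open>f = Log (1 - v X\<^sup>d)\<close>, with powers of \<open>v\<close> for \<open>\<circ>\<close>, the geometric series
  \<open>1 / (1 + v X\<^sup>d)\<close> satisfies this equation: the product of \<open>v\<^sup>m\<close> with the \<open>k\<close>-th power of \<open>v\<close>
  for \<open>\<circ>\<close> splits into insertions of the \<open>k\<close>-th and the \<open>k + 1\<close>-st power, and the alternating
  sum telescopes.

  It remains to compare letters. The products \<open>\<circ>\<close> of letters \<open>g\<^sub>j\<close> are products of polynomials
  in \<open>z = - g\<^sub>1 / \<hbar>\<close>, so \<open>\<psi>\<^sub>P\<close> is \<open>P(z)\<close>, and by the exponential generating function of the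
  Stirling numbers \<open>\<Sum>\<^sub>k \<hbar>\<^sup>-\<^sup>k \<phi>\<^sub>k u\<^sup>k / k!\<close> is \<open>- Log (1 + z (e\<^sup>u - 1))\<close>, which is
  \<open>- Log (1 - \<alpha> z)\<close> at \<open>u = Log (1 - \<alpha>)\<close>. The sum over the rotations of \<open>X\<close> is then given by the
  factorization of \<open>1 - x\<^sup>N P(z)\<close>, and \<open>P(1) = 0\<close> removes the term \<open>k = 1\<close>.
\<close>

subsection \<open>Linear extensions\<close>

lemma poly_mapping_eq_sum_single:
  fixes x :: "'a \<Rightarrow>\<^sub>0 'b::comm_monoid_add"
  shows "x = (\<Sum>a\<in>Poly_Mapping.keys x. Poly_Mapping.single a (Poly_Mapping.lookup x a))"
  by (rule poly_mapping_eqI)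
    (simp add: lookup_sum lookup_single when_def in_keys_iff)

text \<open>Multilinear identities are reduced by nested use of this rule to single words and
  letters.\<close>

lemma poly_mapping_induct_single [case_names zero single add]:
  fixes x :: "'a \<Rightarrow>\<^sub>0 'b::comm_monoid_add"
  assumes "P 0" and "\<And>a c. P (Poly_Mapping.single a c)"
    and "\<And>x y. P x \<Longrightarrow> P y \<Longrightarrow> P (x + y)"
  shows "P x"
proof -
  have "P (\<Sum>a\<in>S. Poly_Mapping.single a (Poly_Mapping.lookup x a))" if "finite S" for S
    using that by induction (auto simp: assms)
  then show ?thesis
    using poly_mapping_eq_sum_single[of x] by (metis finite_keys)
qed

lemma lscale_0_left [simp]: "lscale 0 x = 0"
  by (rule poly_mapping_eqI) (simp add: lookup_lscale)

lemma lscale_0_right [simp]: "lscale c 0 = 0"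
  by (rule poly_mapping_eqI) (simp add: lookup_lscale)

lemma lscale_1 [simp]: "lscale 1 x = x"
  by (rule poly_mapping_eqI) (simp add: lookup_lscale)

lemma lscale_lscale [simp]: "lscale c (lscale d x) = lscale (c * d) x"
  by (rule poly_mapping_eqI) (simp add: lookup_lscale algebra_simps)

lemma lscale_add_left: "lscale (c + d) x = lscale c x + lscale d x"
  by (rule poly_mapping_eqI) (simp add: lookup_lscale lookup_add algebra_simps)

lemma lscale_add_right: "lscale c (x + y) = lscale c x + lscale c y"
  by (rule poly_mapping_eqI) (simp add: lookup_lscale lookup_add algebra_simps)

lemma lscale_sum: "lscale c (sum f S) = (\<Sum>i\<in>S. lscale c (f i))"
  by (induction S rule: infinite_finite_induct) (simp_all add: lscale_add_right)

lemma lscale_single [simp]: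
  "lscale c (Poly_Mapping.single a d) = Poly_Mapping.single a (c * d)"
  by (rule poly_mapping_eqI) (simp add: lookup_lscale lookup_single when_def)

text \<open>A common finite range for several elements lets additivity be checked termwise.\<close>

lemma linear_ext_superset:
  assumes "finite S" "Poly_Mapping.keys x \<subseteq> S"
  shows "linear_ext f x = (\<Sum>a\<in>S. lscale (Poly_Mapping.lookup x a) (f a))"
  unfolding linear_ext_def
  by (rule sum.mono_neutral_left) (use assms in \<open>auto simp: in_keys_iff\<close>)

lemma linear_ext_0 [simp]: "linear_ext f 0 = 0"
  by (simp add: linear_ext_def)

lemma linear_ext_add: "linear_ext f (x + y) = linear_ext f x + linear_ext f y"
proof -
  let ?S = "Poly_Mapping.keys x \<union> Poly_Mapping.keys y"
  have "linear_ext f z = (\<Sum>a\<in>?S. lscale (Poly_Mapping.lookup z a) (f a))"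
    if "Poly_Mapping.keys z \<subseteq> ?S" for z
    by (rule linear_ext_superset) (use that in auto)
  then show ?thesis
    by (simp add: Poly_Mapping.keys_add lookup_add lscale_add_left sum.distrib)
qed

lemma linear_ext_lscale: "linear_ext f (lscale c x) = lscale c (linear_ext f x)"
proof -
  have "Poly_Mapping.keys (lscale c x) \<subseteq> Poly_Mapping.keys x"
    by (auto simp: in_keys_iff lookup_lscale)
  then have "linear_ext f (lscale c x) =
      (\<Sum>a\<in>Poly_Mapping.keys x. lscale (Poly_Mapping.lookup (lscale c x) a) (f a))"
    by (intro linear_ext_superset) auto
  then show ?thesis
    by (simp add: linear_ext_def lscale_sum lookup_lscale)
qed

lemma linear_ext_single [simp]: "linear_ext f (Poly_Mapping.single a c) = lscale c (f a)"
  by (subst linear_ext_superset[of "{a}"]) auto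

lemma bilinear_ext_eq_linear_ext:
  "bilinear_ext f x y = linear_ext (\<lambda>a. linear_ext (f a) y) x"
  by (simp add: bilinear_ext_def linear_ext_def lscale_sum)

lemma bilinear_ext_add_left:
  "bilinear_ext f (x + y) z = bilinear_ext f x z + bilinear_ext f y z"
  by (simp add: bilinear_ext_eq_linear_ext linear_ext_add)

lemma bilinear_ext_add_right:
  "bilinear_ext f x (y + z) = bilinear_ext f x y + bilinear_ext f x z"
  by (simp add: bilinear_ext_eq_linear_ext linear_ext_add)
    (simp add: linear_ext_def lscale_add_right sum.distrib)

lemma bilinear_ext_lscale_left:
  "bilinear_ext f (lscale c x) y = lscale c (bilinear_ext f x y)"
  by (simp add: bilinear_ext_eq_linear_ext linear_ext_lscale)

lemma bilinear_ext_lscale_right: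
  "bilinear_ext f x (lscale c y) = lscale c (bilinear_ext f x y)"
  by (simp add: bilinear_ext_eq_linear_ext linear_ext_lscale)
    (simp add: linear_ext_def lscale_sum mult_ac)

lemma bilinear_ext_single:
  "bilinear_ext f (Poly_Mapping.single a c) (Poly_Mapping.single b d) = lscale (c * d) (f a b)"
  by (simp add: bilinear_ext_eq_linear_ext)

lemma bilinear_ext_0 [simp]: "bilinear_ext f 0 y = 0" "bilinear_ext f x 0 = 0"
  by (simp_all add: bilinear_ext_def)

lemmas circ_linear =
  bilinear_ext_add_left[of circ_letter, folded circ_def]
  bilinear_ext_add_right[of circ_letter, folded circ_def]
  bilinear_ext_lscale_left[of circ_letter, folded circ_def]
  bilinear_ext_lscale_right[of circ_letter, folded circ_def]
  bilinear_ext_0[of circ_letter, folded circ_def]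

lemmas circ_single = bilinear_ext_single[of circ_letter, folded circ_def]

lemmas harm_linear =
  bilinear_ext_add_left[of harm_word, folded harm_def]
  bilinear_ext_add_right[of harm_word, folded harm_def]
  bilinear_ext_lscale_left[of harm_word, folded harm_def]
  bilinear_ext_lscale_right[of harm_word, folded harm_def]
  bilinear_ext_0[of harm_word, folded harm_def]

lemmas harm_single = bilinear_ext_single[of harm_word, folded harm_def]

lemma harm_sum_left: "harm (sum f S) y = (\<Sum>i\<in>S. harm (f i) y)"
  by (induction S rule: infinite_finite_induct) (simp_all add: harm_linear)

lemma zmod_to_H1_linear:
  "zmod_to_H1 0 = 0"
  "zmod_to_H1 (x + y) = zmod_to_H1 x + zmod_to_H1 y"
  "zmod_to_H1 (lscale c x) = lscale c (zmod_to_H1 x)"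
  by (simp_all add: zmod_to_H1_def linear_ext_add linear_ext_lscale)

lemma zmod_to_H1_single: "zmod_to_H1 (Poly_Mapping.single a c) = Poly_Mapping.single [a] c"
  by (simp add: zmod_to_H1_def)

lemma zmod_to_H1_sum: "zmod_to_H1 (sum f S) = (\<Sum>i\<in>S. zmod_to_H1 (f i))"
  by (induction S rule: infinite_finite_induct) (simp_all add: zmod_to_H1_linear)

lemma lscale_eq_const_mult: "lscale c x = const_H1 c * x"
  by (simp add: lscale_def const_H1_def mult_map_scale_conv_mult flip: zero_list_def)

lemma one_H1_eq: "(1 :: H1) = Poly_Mapping.single [] 1"
  by (simp flip: zero_list_def)

text \<open>Scalars sit on the empty word, which concatenates trivially on both sides.\<close>

lemma const_H1_central: "const_H1 c * x = x * const_H1 c"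
  by (induction x rule: poly_mapping_induct_single)
    (simp_all add: const_H1_def mult_single plus_list_def algebra_simps)

lemma lscale_mult_left: "lscale c x * y = lscale c (x * y)" for x y :: H1
  by (simp add: lscale_eq_const_mult mult.assoc)

lemma lscale_mult_right: "x * lscale c y = lscale c (x * y)" for x y :: H1
  by (metis lscale_eq_const_mult mult.assoc const_H1_central)

subsection \<open>Harmonic multiplication by letters\<close>

lemma harm_one_left [simp]: "harm 1 y = y"
  unfolding one_H1_eq
  by (induction y rule: poly_mapping_induct_single)
    (simp_all add: harm_linear harm_single harm_word_Nil_left)

text \<open>The defining recursion with one word a single letter, extended by linearity in all three
  arguments to arbitrary combinations of letters.\<close>

lemma harm_snoc:
  "harm (w * zmod_to_H1 x) (zmod_to_H1 a) =
     w * zmod_to_H1 x * zmod_to_H1 a + harm w (zmod_to_H1 a) * zmod_to_H1 x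
       + w * zmod_to_H1 (circ x a)"
proof (induction w rule: poly_mapping_induct_single)
  case (single v c)
  show ?case
  proof (induction x rule: poly_mapping_induct_single)
    case (single u d)
    show ?case
    proof (induction a rule: poly_mapping_induct_single)
      case (single b e)
      \<comment> \<open>Coefficients are pulled out as scalars, leaving an identity of words with
        coefficient 1.\<close>
      have eq: "Poly_Mapping.single w c * y = lscale c (Poly_Mapping.single w 1 * y)"
        "y * Poly_Mapping.single w c = lscale c (y * Poly_Mapping.single w 1)"
        for w c and y :: H1
        using lscale_mult_left[of c "Poly_Mapping.single w 1" y]
          lscale_mult_right[of y c "Poly_Mapping.single w 1"] by simp_all
      have w: "harm_word (v @ [u]) [b] = harm_word v [b] * Poly_Mapping.single [u] 1
        + Poly_Mapping.single (v @ [u]) 1 * Poly_Mapping.single [b] 1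
        + Poly_Mapping.single v 1 * zmod_to_H1 (circ_letter u b)"
        using harm_word_snoc_snoc[of v u "[]" b] by (simp add: harm_word_Nil_right)
      show ?case
        by (simp add: zmod_to_H1_single mult_single plus_list_def harm_single w circ_single
            zmod_to_H1_linear lscale_add_right lscale_mult_left lscale_mult_right
            eq[where c = c] eq[where c = d] eq[where c = e] mult_ac add_ac)
    qed (simp_all add: zmod_to_H1_linear harm_linear circ_linear algebra_simps)
  qed (simp_all add: zmod_to_H1_linear harm_linear circ_linear algebra_simps)
qed (simp_all add: harm_linear algebra_simps)

lemma circ_letter_commute: "circ_letter a b = circ_letter b a"
  by (cases a; cases b) (simp_all add: add.commute)

lemma circ_commute: "circ x y = circ y x"
proof (induction x rule: poly_mapping_induct_single)
  case (single a c)
  then show ?case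
    by (induction y rule: poly_mapping_induct_single)
      (simp_all add: circ_linear circ_single circ_letter_commute mult.commute)
qed (simp_all add: circ_linear)

lemma circ_right_commute: "circ (circ x a) b = circ (circ x b) a"
proof (induction x rule: poly_mapping_induct_single)
  case (single u c)
  show ?case
  proof (induction a rule: poly_mapping_induct_single)
    case (single v d)
    show ?case
    proof (induction b rule: poly_mapping_induct_single)
      case (single w e)
      show ?case
        by (cases u; cases v; cases w) (simp_all add: circ_single mult_ac add_ac)
    qed (simp_all add: circ_linear)
  qed (simp_all add: circ_linear)
qed (simp_all add: circ_linear)

text \<open>Induction on the length of the word: two uses of \<open>harm_snoc\<close> expand each
  side into terms exchanged by swapping \<open>a\<close> and \<open>b\<close>, up to the symmetry of
  \<open>circ\<close> and the induction hypothesis for the shorter word.\<close>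

lemma harm_right_commute:
  "harm (harm w (zmod_to_H1 a)) (zmod_to_H1 b) = harm (harm w (zmod_to_H1 b)) (zmod_to_H1 a)"
proof (induction w rule: poly_mapping_induct_single)
  case (single v c)
  show ?case
  proof (induction v rule: rev_induct)
    case Nil
    have "Poly_Mapping.single [] c = lscale c (1 :: H1)"
      by (simp add: one_H1_eq)
    moreover have "harm (zmod_to_H1 a) (zmod_to_H1 b) = harm (zmod_to_H1 b) (zmod_to_H1 a)"
      using harm_snoc[of 1 a b] harm_snoc[of 1 b a] by (simp add: circ_commute)
    ultimately show ?case
      by (simp add: harm_linear)
  next
    case (snoc u v)
    have "Poly_Mapping.single (v @ [u]) c =
        Poly_Mapping.single v c * zmod_to_H1 (Poly_Mapping.single u 1)"
      by (simp add: zmod_to_H1_single mult_single plus_list_def)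
    with snoc show ?case
      by (simp add: harm_snoc harm_linear circ_right_commute[of _ a b] circ_commute[of a b])
        (simp add: algebra_simps)
  qed
qed (simp_all add: harm_linear)

section \<open>Harmonic products of concatenation powers with letters\<close>

lemma circ_pow_1 [simp]: "circ_pow u (Suc 0) = u"
  by (simp add: circ_pow_def)

lemma circ_pow_Suc_Suc [simp]: "circ_pow u (Suc (Suc n)) = circ (circ_pow u (Suc n)) u"
  by (simp add: circ_pow_def)

text \<open>This is the shuffle product of the power \<open>v ^ m\<close> with the letter
  \<open>a\<close>.\<close>

definition insertions :: "zmod \<Rightarrow> nat \<Rightarrow> zmod \<Rightarrow> H1" where
  "insertions v m a = (\<Sum>i\<le>m. zmod_to_H1 v ^ i * zmod_to_H1 a * zmod_to_H1 v ^ (m - i))"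

lemma insertions_Suc:
  "insertions v (Suc m) a =
     insertions v m a * zmod_to_H1 v + zmod_to_H1 v ^ Suc m * zmod_to_H1 a"
proof -
  have "(\<Sum>i\<le>m. zmod_to_H1 v ^ i * zmod_to_H1 a * zmod_to_H1 v ^ (Suc m - i)) =
    insertions v m a * zmod_to_H1 v"
    unfolding insertions_def sum_distrib_right
    by (rule sum.cong) (auto simp: Suc_diff_le mult.assoc power_commutes)
  then show ?thesis
    by (simp add: insertions_def)
qed

lemma insertions_self: "insertions v m v = of_nat (Suc m) * zmod_to_H1 v ^ Suc m"
proof -
  have "zmod_to_H1 v ^ i * zmod_to_H1 v * zmod_to_H1 v ^ (m - i) = zmod_to_H1 v ^ Suc m"
    if "i \<le> m" for i
  proof -
    have "zmod_to_H1 v ^ i * zmod_to_H1 v * zmod_to_H1 v ^ (m - i) =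
        zmod_to_H1 v ^ (Suc i + (m - i))"
      by (simp only: power_add power_Suc2)
    then show ?thesis
      using that by simp
  qed
  then show ?thesis
    by (simp add: insertions_def)
qed

text \<open>The letter \<open>a\<close> is either inserted between the factors \<open>v\<close> or
  merged with one of them, which leaves \<open>m\<close> factors around
  \<open>circ v a\<close>.\<close>

lemma harm_power_Suc:
  "harm (zmod_to_H1 v ^ Suc m) (zmod_to_H1 a) =
     insertions v (Suc m) a + insertions v m (circ v a)"
proof (induction m)
  case 0
  show ?case
    using harm_snoc[of 1 v a] by (simp add: insertions_def algebra_simps)
next
  case (Suc m)
  have "harm (zmod_to_H1 v ^ Suc (Suc m)) (zmod_to_H1 a) =
      harm (zmod_to_H1 v ^ Suc m * zmod_to_H1 v) (zmod_to_H1 a)"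
    by (simp only: power_Suc2)
  also have "\<dots> = zmod_to_H1 v ^ Suc (Suc m) * zmod_to_H1 a
      + (insertions v (Suc m) a + insertions v m (circ v a)) * zmod_to_H1 v
      + zmod_to_H1 v ^ Suc m * zmod_to_H1 (circ v a)"
    unfolding harm_snoc Suc by (simp only: power_Suc2)
  also have "\<dots> = insertions v (Suc (Suc m)) a + insertions v (Suc m) (circ v a)"
    by (simp only: insertions_Suc algebra_simps)
  finally show ?case .
qed

lemma sum_harm_power:
  "(\<Sum>k\<le>j. (- 1) ^ k * harm (zmod_to_H1 v ^ (j - k)) (zmod_to_H1 (circ_pow v (Suc k)))) =
     of_nat (Suc j) * zmod_to_H1 v ^ Suc j"
proof -
  define h where "h k = insertions v (j - k) (circ_pow v (Suc k))" for k
  have step: "harm (zmod_to_H1 v ^ (j - k)) (zmod_to_H1 (circ_pow v (Suc k))) = h k + h (Suc k)"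
    if "k < j" for k
  proof -
    have "circ v (circ_pow v (Suc k)) = circ_pow v (Suc (Suc k))"
      unfolding circ_pow_Suc_Suc by (rule circ_commute)
    moreover have "j - k = Suc (j - Suc k)"
      using that by (rule Suc_diff_Suc[symmetric])
    ultimately show ?thesis
      by (simp only: h_def harm_power_Suc)
  qed
  \<comment> \<open>Telescoping stops before \<open>k = j\<close>, where the power is 1 and
    \<open>step\<close> does not apply; that last term is \<open>h j\<close> alone and cancels the
    remainder.\<close>
  have "(\<Sum>k<i. (- 1) ^ k * harm (zmod_to_H1 v ^ (j - k)) (zmod_to_H1 (circ_pow v (Suc k)))) =
      h 0 - (- 1) ^ i * h i" if "i \<le> j" for i
    using that by (induction i) (simp_all add: step algebra_simps)
  from this[of j] have "(\<Sum>k<j. (- 1) ^ k * harm (zmod_to_H1 v ^ (j - k)) (zmod_to_H1 (circ_pow v (Suc k))))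
      + (- 1) ^ j * harm (zmod_to_H1 v ^ (j - j)) (zmod_to_H1 (circ_pow v (Suc j))) = h 0"
    by (simp add: h_def insertions_def)
  moreover have "h 0 = of_nat (Suc j) * zmod_to_H1 v ^ Suc j"
    using insertions_self[of v j] by (simp add: h_def)
  ultimately show ?thesis
    by (simp only: lessThan_Suc_atMost[symmetric] sum.lessThan_Suc)
qed

subsection \<open>Harmonic exponentials of series of letters\<close>

text \<open>The \<open>n\<close>-th summand has order at least \<open>n\<close>, so the coefficient
  of index \<open>m\<close> in the partial sums is constant past \<open>m\<close>; this is X-adic
  convergence.\<close>

lemma fps_nth_suminf:
  fixes s :: "nat \<Rightarrow> 'a::ab_group_add fps"
  assumes "\<And>n m. m < n \<Longrightarrow> fps_nth (s n) m = 0"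
  shows "fps_nth (suminf s) m = (\<Sum>n\<le>m. fps_nth (s n) m)"
proof -
  have "(\<lambda>M. \<Sum>n<M. s n) \<longlonglongrightarrow> Abs_fps (\<lambda>m. \<Sum>n\<le>m. fps_nth (s n) m)"
  proof (rule tendsto_fpsI)
    fix m
    show "\<forall>\<^sub>F M in sequentially. fps_nth (\<Sum>n<M. s n) m =
        fps_nth (Abs_fps (\<lambda>m. \<Sum>n\<le>m. fps_nth (s n) m)) m"
      using eventually_gt_at_top[of m]
    proof eventually_elim
      case (elim M)
      have "(\<Sum>n<M. fps_nth (s n) m) = (\<Sum>n\<le>m. fps_nth (s n) m)"
        by (rule sum.mono_neutral_right) (use elim assms in auto)
      then show ?case
        by (simp add: fps_sum_nth)
    qed
  qed
  then have "s sums Abs_fps (\<lambda>m. \<Sum>n\<le>m. fps_nth (s n) m)"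
    by (simp add: sums_def)
  then show ?thesis
    by (simp add: sums_iff)
qed

definition scalar :: "complex \<Rightarrow> H1" where
  "scalar c = const_H1 (laurent_const c)"

lemma laurent_const_ring_hom:
  "laurent_const 0 = 0" "laurent_const 1 = 1"
  "laurent_const (c + d) = laurent_const c + laurent_const d"
  "laurent_const (c * d) = laurent_const c * laurent_const d"
  "laurent_const (- c) = - laurent_const c"
  by (simp_all add: laurent_const_def mult_single single_add single_uminus)

lemma scalar_ring_hom:
  "scalar 0 = 0" "scalar 1 = 1" "scalar (c + d) = scalar c + scalar d"
  "scalar (c * d) = scalar c * scalar d" "scalar (- c) = - scalar c"
  by (simp_all add: scalar_def laurent_const_ring_hom const_H1_def one_H1_eq mult_single
      plus_list_def single_add single_uminus)

lemma scalar_of_nat: "scalar (of_nat n) = of_nat n"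
  by (induction n) (simp_all add: scalar_ring_hom)

lemma scalar_mult: "scalar c * x = lscale (laurent_const c) x"
  by (simp add: scalar_def lscale_eq_const_mult)

lemma scalar_central: "scalar c * x = x * scalar c"
  by (simp add: scalar_def const_H1_central)

lemma mult_scalar_left_commute: "x * (scalar c * y) = scalar c * (x * y)"
  by (metis mult.assoc scalar_central)

lemma harm_scalar_left: "harm (scalar c * x) y = scalar c * harm x y"
  by (simp add: scalar_mult harm_linear)

lemma harm_scalar_right: "harm x (scalar c * y) = scalar c * harm x y"
  by (simp add: scalar_mult harm_linear)

lemma harm_of_nat_left: "harm (of_nat n * x) y = of_nat n * harm x y"
  by (metis harm_scalar_left scalar_of_nat)

lemma harm_of_nat_right: "harm x (of_nat n * y) = of_nat n * harm x y"
  by (metis harm_scalar_right scalar_of_nat)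

text \<open>Positive integers are invertible through complex scalars.\<close>

lemma of_nat_mult_H1_cancel:
  fixes x y :: H1
  assumes "of_nat n * x = of_nat n * y" "n > 0"
  shows "x = y"
proof -
  have "scalar (1 / of_nat n) * (of_nat n * z) = z" for z
    using assms(2) by (simp add: mult.assoc[symmetric] scalar_ring_hom(2)
        flip: scalar_of_nat scalar_ring_hom(4))
  then show ?thesis
    using assms(1) by metis
qed

definition letter_series :: "(nat \<Rightarrow> zmod) \<Rightarrow> H1 fps" where
  "letter_series a = Abs_fps (\<lambda>n. zmod_to_H1 (a n))"

definition euler :: "H1 fps \<Rightarrow> H1 fps" where
  "euler F = Abs_fps (\<lambda>n. of_nat n * fps_nth F n)"

text \<open>The Euler operator on letters, so that the derivative of a letter series is again a
  letter series.\<close>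

definition euler_letters :: "(nat \<Rightarrow> zmod) \<Rightarrow> nat \<Rightarrow> zmod" where
  "euler_letters a n = lscale (laurent_const (of_nat n)) (a n)"

lemma euler_letter_series: "euler (letter_series a) = letter_series (euler_letters a)"
  by (rule fps_ext)
    (simp add: euler_def letter_series_def euler_letters_def zmod_to_H1_linear
      flip: scalar_mult scalar_of_nat)

lemma euler_fps_harm: "euler (fps_harm F G) = fps_harm (euler F) G + fps_harm F (euler G)"
proof (rule fps_ext)
  fix n
  have "of_nat n * harm (fps_nth F i) (fps_nth G (n - i)) =
      of_nat i * harm (fps_nth F i) (fps_nth G (n - i)) +
      of_nat (n - i) * harm (fps_nth F i) (fps_nth G (n - i))" if "i \<le> n" for i
    using that by (simp flip: distrib_right of_nat_add)
  then show "fps_nth (euler (fps_harm F G)) n =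
      fps_nth (fps_harm (euler F) G + fps_harm F (euler G)) n"
    by (simp add: euler_def fps_harm_def harm_of_nat_left harm_of_nat_right sum_distrib_left
        flip: sum.distrib del: of_nat_diff cong: sum.cong_simp)
qed

lemma fps_harm_right_commute:
  "fps_harm (fps_harm F (letter_series a)) (letter_series b) =
     fps_harm (fps_harm F (letter_series b)) (letter_series a)"
proof (rule fps_ext)
  fix n
  let ?h = "\<lambda>a b j i k. harm (harm (fps_nth F j) (zmod_to_H1 (a i))) (zmod_to_H1 (b k))"
  \<comment> \<open>The double convolution is reordered with the degree of \<open>F\<close>
    outermost; the degrees of the two letter series then add up to \<open>n - j\<close>.\<close>
  have eq: "fps_nth (fps_harm (fps_harm F (letter_series a)) (letter_series b)) n =
      (\<Sum>j=0..n. \<Sum>i=0..n-j. ?h a b j i (n - j - i))" for a b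
    using fps_mult_assoc_lemma[where f = "?h a b" and n = n and k = n]
    by (simp add: fps_harm_def letter_series_def harm_sum_left atMost_atLeast0)
  have "(\<Sum>i=0..n-j. ?h a b j i (n - j - i)) = (\<Sum>i=0..n-j. ?h b a j i (n - j - i))" for j
  \<comment> \<open>Reversing the inner index exchanges these two degrees.\<close>
  proof (rule sum.reindex_bij_witness[of _ "\<lambda>i. n - j - i" "\<lambda>i. n - j - i"])
    show "?h b a j (n - j - i) (n - j - (n - j - i)) = ?h a b j i (n - j - i)"
      if "i \<in> {0..n-j}" for i
    proof -
      have "n - j - (n - j - i) = i"
        using that by simp
      then show ?thesis
        by (simp only: harm_right_commute)
    qed
  qed auto
  then show "fps_nth (fps_harm (fps_harm F (letter_series a)) (letter_series b)) n =
      fps_nth (fps_harm (fps_harm F (letter_series b)) (letter_series a)) n"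
    by (simp only: eq)
qed

lemma fps_harm_of_nat_left: "fps_harm (of_nat n * F) G = of_nat n * fps_harm F G"
  by (rule fps_ext)
    (simp add: fps_harm_def fps_mult_left_const_nth harm_of_nat_left sum_distrib_left
      flip: fps_of_nat)

lemma fps_harm_one_left [simp]: "fps_harm 1 F = F"
proof (rule fps_ext)
  fix n
  have "harm (fps_nth 1 i) (fps_nth F (n - i)) = (if i = 0 then fps_nth F n else 0)" for i
    by (simp add: harm_linear)
  then show "fps_nth (fps_harm 1 F) n = fps_nth F n"
    by (simp add: fps_harm_def)
qed

text \<open>The power rule: \<open>fps_harm_right_commute\<close> moves the differentiated factor to
  the end in every term of the Leibniz rule.\<close>

lemma euler_fps_harm_pow:
  "euler (fps_harm_pow (letter_series a) (Suc n)) =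
     of_nat (Suc n) * fps_harm (fps_harm_pow (letter_series a) n) (letter_series (euler_letters a))"
proof (induction n)
  case 0
  show ?case
    by (simp add: euler_letter_series)
next
  case (Suc n)
  have "euler (fps_harm_pow (letter_series a) (Suc (Suc n))) =
      fps_harm (euler (fps_harm_pow (letter_series a) (Suc n))) (letter_series a)
      + fps_harm (fps_harm_pow (letter_series a) (Suc n)) (letter_series (euler_letters a))"
    by (simp add: euler_fps_harm euler_letter_series)
  moreover have "fps_harm (fps_harm (fps_harm_pow (letter_series a) n)
        (letter_series (euler_letters a))) (letter_series a) =
      fps_harm (fps_harm_pow (letter_series a) (Suc n)) (letter_series (euler_letters a))"
    unfolding fps_harm_pow.simps by (rule fps_harm_right_commute)
  ultimately show ?case
    unfolding Suc fps_harm_of_nat_left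
    by (simp only: of_nat_Suc[of "Suc n"] distrib_right mult_1_left add.commute)
qed

lemma fps_nth_fps_harm_pow_less:
  assumes "fps_nth f 0 = 0"
  shows "m < n \<Longrightarrow> fps_nth (fps_harm_pow f n) m = 0"
proof (induction n arbitrary: m)
  case (Suc n)
  have "harm (fps_nth (fps_harm_pow f n) i) (fps_nth f (m - i)) = 0" if "i \<le> m" for i
    using that Suc assms by (cases "i < n") (auto simp: harm_linear)
  then show ?case
    by (simp add: fps_harm_def)
qed simp

text \<open>The free bound \<open>M\<close> lets coefficients of different index share one range of
  summation.\<close>

lemma fps_nth_exp_harm:
  assumes "fps_nth f 0 = 0" "m \<le> M"
  shows "fps_nth (exp_harm f) m = (\<Sum>n\<le>M. scalar (1 / fact n) * fps_nth (fps_harm_pow f n) m)"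
proof -
  have "fps_nth (exp_harm f) m = fps_nth 1 m +
      (\<Sum>n\<le>m. scalar (1 / fact (Suc n)) * fps_nth (fps_harm_pow f (Suc n)) m)"
    unfolding exp_harm_def fps_add_nth
    by (subst fps_nth_suminf)
      (simp_all add: fps_nth_fps_harm_pow_less[OF assms(1)] fps_mult_left_const_nth scalar_def
        del: fps_harm_pow.simps(2))
  also have "\<dots> = (\<Sum>n\<le>Suc m. scalar (1 / fact n) * fps_nth (fps_harm_pow f n) m)"
    by (simp add: sum.atMost_Suc_shift scalar_ring_hom del: fps_harm_pow.simps(2) fact_Suc
        sum.atMost_Suc)
  also have "\<dots> = (\<Sum>n\<le>Suc M. scalar (1 / fact n) * fps_nth (fps_harm_pow f n) m)"
    by (rule sum.mono_neutral_left)
      (use assms(2) in \<open>auto simp: fps_nth_fps_harm_pow_less[OF assms(1)] simp del: fps_harm_pow.simps(2)\<close>)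
  also have "\<dots> = (\<Sum>n\<le>M. scalar (1 / fact n) * fps_nth (fps_harm_pow f n) m)"
    using assms(2) fps_nth_fps_harm_pow_less[OF assms(1), of m "Suc M"]
    by (simp del: fps_harm_pow.simps(2))
  finally show ?thesis .
qed

lemma euler_exp_harm:
  assumes "a 0 = 0"
  shows "of_nat m * fps_nth (exp_harm (letter_series a)) m =
    (\<Sum>i\<le>m. harm (fps_nth (exp_harm (letter_series a)) i) (zmod_to_H1 (euler_letters a (m - i))))"
proof -
  let ?p = "fps_harm_pow (letter_series a)"
  have f0: "fps_nth (letter_series a) 0 = 0"
    by (simp add: letter_series_def assms zmod_to_H1_linear)
  have "of_nat m * fps_nth (exp_harm (letter_series a)) m =
      (\<Sum>n\<le>Suc m. scalar (1 / fact n) * fps_nth (euler (?p n)) m)"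
    by (simp only: fps_nth_exp_harm[OF f0 le_SucI[OF order.refl]] sum_distrib_left euler_def
        fps_nth_Abs_fps mult_scalar_left_commute)
  \<comment> \<open>The term \<open>n = 0\<close> is the Euler derivative of 1 and vanishes; the
    bound \<open>Suc m\<close> was chosen so that the shift leaves \<open>n \<le> m\<close>.\<close>
  also have "\<dots> = (\<Sum>n\<le>m. scalar (1 / fact (Suc n)) * fps_nth (euler (?p (Suc n))) m)"
    by (simp only: sum.atMost_Suc_shift)
      (simp add: euler_def del: fps_harm_pow.simps(2) fact_Suc)
  also have "\<dots> = (\<Sum>n\<le>m. scalar (1 / fact n) *
      fps_nth (fps_harm (?p n) (letter_series (euler_letters a))) m)"
  proof (rule sum.cong)
    fix n
    have "1 / fact (Suc n) * of_nat (Suc n) = (1 / fact n :: complex)"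
      by (simp add: divide_simps del: of_nat_Suc)
    then have "scalar (1 / fact (Suc n)) * of_nat (Suc n) = scalar (1 / fact n)"
      by (metis scalar_of_nat scalar_ring_hom(4))
    then show "scalar (1 / fact (Suc n)) * fps_nth (euler (?p (Suc n))) m =
        scalar (1 / fact n) * fps_nth (fps_harm (?p n) (letter_series (euler_letters a))) m"
      unfolding euler_fps_harm_pow fps_of_nat[symmetric] fps_mult_left_const_nth
      by (simp only: mult.assoc[symmetric])
  qed simp
  also have "\<dots> = (\<Sum>n\<le>m. \<Sum>i\<le>m. scalar (1 / fact n) *
      harm (fps_nth (?p n) i) (zmod_to_H1 (euler_letters a (m - i))))"
    by (simp add: fps_harm_def letter_series_def sum_distrib_left)
  also have "\<dots> = (\<Sum>i\<le>m. harm (\<Sum>n\<le>m. scalar (1 / fact n) * fps_nth (?p n) i)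
      (zmod_to_H1 (euler_letters a (m - i))))"
    by (subst sum.swap) (simp add: harm_sum_left harm_scalar_left)
  also have "\<dots> = (\<Sum>i\<le>m. harm (fps_nth (exp_harm (letter_series a)) i)
      (zmod_to_H1 (euler_letters a (m - i))))"
    by (rule sum.cong) (simp_all add: fps_nth_exp_harm[OF f0])
  finally show ?thesis .
qed

text \<open>The equation of \<open>euler_exp_harm\<close> determines each coefficient from the lower
  ones.\<close>

lemma exp_harm_eqI:
  assumes "a 0 = 0" "fps_nth W 0 = 1"
    and rec: "\<And>m. of_nat m * fps_nth W m =
      (\<Sum>i\<le>m. harm (fps_nth W i) (zmod_to_H1 (euler_letters a (m - i))))"
  shows "exp_harm (letter_series a) = W"
proof (rule fps_ext)
  fix m
  show "fps_nth (exp_harm (letter_series a)) m = fps_nth W m"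
  proof (induction m rule: less_induct)
    case (less m)
    show ?case
    proof (cases "m = 0")
      case True
      have "fps_nth (letter_series a) 0 = 0"
        by (simp add: letter_series_def assms zmod_to_H1_linear)
      from fps_nth_exp_harm[OF this le0, of 0] True assms show ?thesis
        by (simp add: scalar_ring_hom)
    next
      case False
      have "of_nat m * fps_nth (exp_harm (letter_series a)) m = of_nat m * fps_nth W m"
        unfolding euler_exp_harm[of a, OF assms(1)] rec
      proof (rule sum.cong)
        fix i assume "i \<in> {..m}"
        then show "harm (fps_nth (exp_harm (letter_series a)) i) (zmod_to_H1 (euler_letters a (m - i))) =
            harm (fps_nth W i) (zmod_to_H1 (euler_letters a (m - i)))"
          \<comment> \<open>The term \<open>i = m\<close> carries the Euler factor 0, so only
            smaller indices remain.\<close>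
          by (cases "i = m")
            (simp_all add: less euler_letters_def laurent_const_ring_hom zmod_to_H1_linear harm_linear)
      qed simp
      then show ?thesis
        using False of_nat_mult_H1_cancel by blast
    qed
  qed
qed

section \<open>The geometric series as a harmonic exponential\<close>

lemma fps_nth_recip_one_plus_monomial:
  assumes "d > 0"
  shows "fps_nth (recip_one_plus (fps_const c * fps_X ^ d)) m =
    (if d dvd m then (- c) ^ (m div d) else 0)"
proof -
  \<comment> \<open>The coefficient ring is non-commutative; the factors are collected because
    powers of \<open>fps_X\<close> are central.\<close>
  have pow: "(- (fps_const c * fps_X ^ d)) ^ n = fps_const ((- c) ^ n) * fps_X ^ (d * n)" for n
  proof (induction n)
    case (Suc n)
    have "- (fps_const c * fps_X ^ d) = fps_const (- c) * fps_X ^ d"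
      by (simp flip: fps_const_neg)
    then have "fps_const ((- c) ^ n) * fps_X ^ (d * n) * (- (fps_const c * fps_X ^ d)) =
        fps_const ((- c) ^ n) * fps_X ^ (d * n) * (fps_const (- c) * fps_X ^ d)"
      by (simp only:)
    also have "\<dots> =
        fps_const ((- c) ^ n) * (fps_X ^ (d * n) * fps_const (- c)) * fps_X ^ d"
      by (simp only: mult.assoc)
    also have "\<dots> = fps_const ((- c) ^ n) * (fps_const (- c) * fps_X ^ (d * n)) * fps_X ^ d"
      by (simp only: fps_mult_fps_X_power_commute)
    also have "\<dots> = (fps_const ((- c) ^ n) * fps_const (- c)) * (fps_X ^ (d * n) * fps_X ^ d)"
      by (simp only: mult.assoc)
    also have "\<dots> = fps_const ((- c) ^ Suc n) * fps_X ^ (d * Suc n)"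
      by (simp only: fps_const_mult power_Suc2 mult_Suc_right add.commute flip: power_add)
    finally show ?case
      using Suc unfolding power_Suc2[of "- (fps_const c * fps_X ^ d)"] by simp
  qed simp
  have nth: "fps_nth ((- (fps_const c * fps_X ^ d)) ^ n) m =
      (if m = d * n then (- c) ^ n else 0)" for n m
    unfolding pow fps_mult_left_const_nth fps_X_power_nth by simp
  have "fps_nth (recip_one_plus (fps_const c * fps_X ^ d)) m =
      (\<Sum>n\<le>m. if m = d * n then (- c) ^ n else 0)"
    unfolding recip_one_plus_def
    by (subst fps_nth_suminf) (use assms in \<open>auto simp: nth\<close>)
  also have "\<dots> = (if d dvd m then (- c) ^ (m div d) else 0)"
  proof (cases "d dvd m")
    case True
    then obtain q where m: "m = d * q" ..
    have "(\<Sum>n\<le>m. if m = d * n then (- c) ^ n else 0) = (\<Sum>n\<in>{q}. (- c) ^ n)"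
      by (rule sum.mono_neutral_cong_right) (use m assms in auto)
    then show ?thesis
      using m assms by simp
  qed (auto intro!: sum.neutral)
  finally show ?thesis .
qed

text \<open>The logarithm of \<open>1 - v X\<^sup>d\<close>, powers of \<open>v\<close> being taken for \<^const>\<open>circ\<close>.\<close>
definition log_coeff :: "zmod \<Rightarrow> nat \<Rightarrow> nat \<Rightarrow> zmod" where
  "log_coeff v d n =
    (if n > 0 \<and> d dvd n then lscale (laurent_const (- of_nat d / of_nat n)) (circ_pow v (n div d)) else 0)"

text \<open>\<open>exp_harm_eqI\<close> applies to the geometric series: its recursion is trivial
  unless \<open>m = d * Suc j\<close>, and is then \<open>sum_harm_power\<close> up to sign and the
  factor \<open>d\<close>.\<close>

theorem exp_harm_log:
  assumes "d > 0"
  shows "exp_harm (letter_series (log_coeff v d)) =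
    recip_one_plus (fps_const (zmod_to_H1 v) * fps_X ^ d)"
proof (rule exp_harm_eqI)
  show "log_coeff v d 0 = 0"
    by (simp add: log_coeff_def)
  let ?W = "recip_one_plus (fps_const (zmod_to_H1 v) * fps_X ^ d)"
  note W = fps_nth_recip_one_plus_monomial[OF assms, of "zmod_to_H1 v"]
  show "fps_nth ?W 0 = 1"
    by (simp add: W)
  \<comment> \<open>The Euler factor \<open>n\<close> cancels the denominator in
    \<open>log_coeff\<close>.\<close>
  have eul: "zmod_to_H1 (euler_letters (log_coeff v d) n) =
      (if n > 0 \<and> d dvd n then - (of_nat d * zmod_to_H1 (circ_pow v (n div d))) else 0)" for n
  proof (cases "n > 0 \<and> d dvd n")
    case True
    then have "laurent_const (of_nat n) * laurent_const (- of_nat d / of_nat n) =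
        laurent_const (- of_nat d)"
      by (simp flip: laurent_const_ring_hom(4))
    with True show ?thesis
      by (simp add: euler_letters_def log_coeff_def zmod_to_H1_linear scalar_ring_hom scalar_of_nat
          flip: scalar_mult)
  qed (auto simp: euler_letters_def log_coeff_def zmod_to_H1_linear)
  have harm_minus: "harm x (- y) = - harm x y" for x y
    using harm_linear(2)[of x "- y" y] by (simp add: harm_linear add_eq_0_iff2)
  show "of_nat m * fps_nth ?W m =
      (\<Sum>i\<le>m. harm (fps_nth ?W i) (zmod_to_H1 (euler_letters (log_coeff v d) (m - i))))" for m
  proof (cases "d dvd m \<and> m > 0")
    case False
    \<comment> \<open>Either \<open>m = 0\<close>, or \<open>d\<close> does not divide
      \<open>m\<close> and hence not both \<open>i\<close> and \<open>m - i\<close>.\<close>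
    have "harm (fps_nth ?W i) (zmod_to_H1 (euler_letters (log_coeff v d) (m - i))) = 0"
      if "i \<le> m" for i
      using False that by (auto simp: W eul harm_linear dvd_diff_nat dest: dvd_diffD)
    with False show ?thesis
      by (auto simp: W)
  next
    case True
    then obtain j where m: "m = d * Suc j"
      by (metis dvdE gr0_implies_Suc mult_is_0 neq0_conv)
    let ?V = "zmod_to_H1 v"
    let ?u = "\<lambda>k. zmod_to_H1 (circ_pow v k)"
    have harm_sign: "harm ((- ?V) ^ n) x = (- 1) ^ n * harm (?V ^ n) x" for n x
    proof -
      have "(- ?V) ^ n = scalar ((- 1) ^ n) * ?V ^ n"
        by (subst power_minus) (cases "even n"; simp add: scalar_ring_hom)
      moreover have "scalar ((- 1) ^ n) = (- 1) ^ n"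
        by (cases "even n") (simp_all add: scalar_ring_hom)
      ultimately show ?thesis
        by (metis harm_scalar_left)
    qed
    have "(\<Sum>i\<le>m. harm (fps_nth ?W i) (zmod_to_H1 (euler_letters (log_coeff v d) (m - i)))) =
        (\<Sum>k\<le>j. harm ((- ?V) ^ (j - k)) (- (of_nat d * ?u (Suc k))))"
    proof -
      \<comment> \<open>These are the multiples of \<open>d\<close> below \<open>m\<close>; the
        multiple \<open>m\<close> itself is left out since it meets the letter coefficient of index
        0, which vanishes.\<close>
      let ?h = "\<lambda>k. d * (j - k)"
      let ?t = "\<lambda>i. harm (fps_nth ?W i) (zmod_to_H1 (euler_letters (log_coeff v d) (m - i)))"
      have "sum ?t {..m} = sum ?t (?h ` {..j})"
      proof (rule sum.mono_neutral_right)
        show "?h ` {..j} \<subseteq> {..m}"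
          by (auto simp: m intro: le_trans[of _ "d * j"])
        show "\<forall>i\<in>{..m} - ?h ` {..j}. ?t i = 0"
        proof
          fix i assume i: "i \<in> {..m} - ?h ` {..j}"
          have "i = m" if "d dvd i"
          proof -
            from that obtain q where q: "i = d * q" ..
            then have "d * q \<le> d * Suc j"
              using i m by (simp del: mult_Suc_right)
            then have "q \<le> Suc j"
              using assms by (simp del: mult_Suc_right)
            moreover have "q \<noteq> j - k" if "k \<le> j" for k
              using i q that by auto
            then have "\<not> q \<le> j"
              by (metis diff_diff_cancel diff_le_self)
            ultimately show "i = m"
              using q m by (simp add: le_Suc_eq)
          qed
          then show "?t i = 0"
            by (cases "d dvd i") (simp_all add: W eul harm_linear)
        qed
      qed simp
      also have "\<dots> = (\<Sum>k\<le>j. ?t (?h k))"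
        by (rule sum.reindex_cong[OF _ refl refl]) (use assms in \<open>auto simp: inj_on_def\<close>)
      also have "\<dots> = (\<Sum>k\<le>j. harm ((- ?V) ^ (j - k)) (- (of_nat d * ?u (Suc k))))"
      proof (rule sum.cong)
        fix k assume "k \<in> {..j}"
        then have "m - ?h k = d * Suc k"
          unfolding m diff_mult_distrib2[symmetric] by simp
        then show "?t (?h k) = harm ((- ?V) ^ (j - k)) (- (of_nat d * ?u (Suc k)))"
          using assms by (simp add: W eul)
      qed simp
      finally show ?thesis .
    qed
    also have "\<dots> = (\<Sum>k\<le>j. (- 1) ^ Suc j * (of_nat d * ((- 1) ^ k * harm (?V ^ (j - k)) (?u (Suc k)))))"
    proof (rule sum.cong)
      fix k assume "k \<in> {..j}"
      then have sgn: "(- 1) ^ (j - k) = (- 1) ^ j * ((- 1) ^ k :: H1)"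
        by (simp flip: power_add) (metis add_diff_inverse_nat diff_is_0_eq' even_add even_diff_nat minus_one_power_iff not_less)
      show "harm ((- ?V) ^ (j - k)) (- (of_nat d * ?u (Suc k))) =
          (- 1) ^ Suc j * (of_nat d * ((- 1) ^ k * harm (?V ^ (j - k)) (?u (Suc k))))"
        unfolding harm_minus harm_of_nat_right harm_sign sgn
        by (cases "even j"; cases "even k") simp_all
    qed simp
    also have "\<dots> = (- 1) ^ Suc j * (of_nat d * (of_nat (Suc j) * ?V ^ Suc j))"
      by (simp only: sum_harm_power flip: sum_distrib_left)
    also have "\<dots> = of_nat m * (- ?V) ^ Suc j"
      unfolding m of_nat_mult power_minus[of ?V] by (cases "even j") (simp_all add: mult.assoc)
    finally show ?thesis
      using m assms by (simp add: W)
  qed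
qed

subsection \<open>Logarithms and Stirling numbers\<close>

lemma fps_deriv_log_one_minus: "fps_deriv fps_log_one_minus * (1 - fps_X) = - 1"
proof (rule fps_ext)
  fix n
  have d: "fps_deriv fps_log_one_minus = Abs_fps (\<lambda>_. - 1)"
    by (rule fps_ext) (simp add: fps_log_one_minus_def del: of_nat_Suc)
  show "fps_nth (fps_deriv fps_log_one_minus * (1 - fps_X)) n = fps_nth (- 1) n"
    by (simp add: d algebra_simps)
qed

lemma fps_nth_log_one_minus_0 [simp]: "fps_nth fps_log_one_minus 0 = 0"
  by (simp add: fps_log_one_minus_def)

text \<open>The logarithmic derivative of \<open>F\<close> without division, by the chain
  rule.\<close>

lemma fps_deriv_log_compose:
  assumes "fps_nth F 0 = 1"
  shows "fps_deriv (fps_log_one_minus oo (1 - F)) * F = fps_deriv F"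
proof -
  have F: "fps_nth (1 - F) 0 = 0"
    using assms by simp
  have "(fps_deriv fps_log_one_minus oo (1 - F)) * ((1 - fps_X) oo (1 - F)) = - 1"
    using fps_deriv_log_one_minus
    by (simp flip: fps_compose_mult_distrib[OF F] add: fps_compose_uminus)
  then have "(fps_deriv fps_log_one_minus oo (1 - F)) * F = - 1"
    using F by (simp add: fps_compose_sub_distrib)
  moreover have "fps_deriv (fps_log_one_minus oo (1 - F)) * F =
      - ((fps_deriv fps_log_one_minus oo (1 - F)) * F) * fps_deriv F"
    by (simp add: fps_compose_deriv[OF F] mult_ac)
  ultimately show ?thesis
    by simp
qed

text \<open>Both sides have the same logarithmic derivative and constant term 0.\<close>

lemma fps_log_mult:
  assumes "fps_nth F 0 = 1" "fps_nth G 0 = 1"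
  shows "fps_log_one_minus oo (1 - F * G) =
    (fps_log_one_minus oo (1 - F)) + (fps_log_one_minus oo (1 - G))"
proof -
  let ?l = "\<lambda>F. fps_log_one_minus oo (1 - F)"
  have "fps_deriv (?l (F * G)) * (F * G) = (fps_deriv (?l F) * F) * G + F * (fps_deriv (?l G) * G)"
    using assms by (simp add: fps_deriv_log_compose)
  then have "fps_deriv (?l (F * G)) * (F * G) = fps_deriv (?l F + ?l G) * (F * G)"
    by (simp add: algebra_simps)
  moreover have "F * G \<noteq> 0"
    using assms by (metis fps_nonzeroI mult_eq_0_iff zero_neq_one)
  ultimately have "fps_deriv (?l (F * G)) = fps_deriv (?l F + ?l G)"
    by simp
  then show ?thesis
    unfolding fps_deriv_eq_iff by simp
qed

lemma fps_log_prod: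
  assumes "\<And>i. i \<in> S \<Longrightarrow> fps_nth (F i) 0 = 0"
  shows "fps_log_one_minus oo (1 - (\<Prod>i\<in>S. 1 - F i)) = (\<Sum>i\<in>S. fps_log_one_minus oo F i)"
  using assms
proof (induction S rule: infinite_finite_induct)
  case (insert i S)
  have "fps_nth (\<Prod>i\<in>S. 1 - F i) 0 = 1"
    using insert.hyps(1) insert.prems by (induction S) auto
  then show ?case
    using insert by (simp add: fps_log_mult)
qed simp_all

text \<open>Passing to \<open>fps_ln 1\<close>, the series of Log (1 + X), gives access to the known
  compositional inverse of \<open>fps_exp 1 - 1\<close>.\<close>

lemma exp_minus_one_compose_log:
  "(fps_exp 1 - 1) oo fps_log_one_minus = (- fps_X :: complex fps)"
proof -
  have ln: "fps_log_one_minus = fps_ln 1 oo (- fps_X)"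
  proof (rule fps_ext)
    fix n
    have "(- 1) ^ k * (- 1) ^ k = (1 :: complex)" for k
      by (simp flip: power_mult_distrib)
    then show "fps_nth fps_log_one_minus n = fps_nth (fps_ln 1 oo (- fps_X)) n"
      by (cases n) (simp_all add: fps_log_one_minus_def fps_compose_uminus' fps_ln_nth del: of_nat_Suc)
  qed
  have "(fps_exp 1 - 1) oo fps_ln 1 = (fps_X :: complex fps)"
    by (simp add: fps_ln_fps_exp_inv fps_inv_right)
  then show ?thesis
    by (simp add: ln fps_compose_assoc)
qed

text \<open>For E = e^u - 1, the equation E' = E + 1 gives (E^(i+1))' = (i+1) (E^(i+1) + E^i), which
  is the Stirling recurrence up to factorials.\<close>

lemma fps_nth_exp_minus_one_power:
  "fps_nth ((fps_exp 1 - 1) ^ j) k = (fact j * of_nat (Stirling k j) / fact k :: complex)"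
proof (induction k arbitrary: j)
  case 0
  show ?case
    by (cases j) simp_all
next
  case (Suc k)
  show ?case
  proof (cases j)
    case (Suc i)
    let ?E = "fps_exp 1 - 1 :: complex fps"
    have "fps_deriv (?E ^ Suc i) = of_nat (Suc i) * fps_deriv ?E * ?E ^ i"
      by (simp only: fps_deriv_power fps_of_nat diff_Suc_1)
    then have "fps_deriv (?E ^ Suc i) = of_nat (Suc i) * (?E ^ Suc i + ?E ^ i)"
      by (simp add: algebra_simps del: of_nat_Suc)
    then have "of_nat (Suc k) * fps_nth (?E ^ Suc i) (Suc k) =
        of_nat (Suc i) * (fps_nth (?E ^ Suc i) k + fps_nth (?E ^ i) k)"
      by (metis fps_deriv_nth fps_add_nth fps_mult_of_nat_nth(1) Suc_eq_plus1)
    moreover have "of_nat (Stirling (Suc k) (Suc i)) =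
        of_nat (Suc i) * of_nat (Stirling k (Suc i)) + (of_nat (Stirling k i) :: complex)"
      by (simp only: Stirling.simps of_nat_add of_nat_mult)
    ultimately show ?thesis
      unfolding Suc Suc.IH
      by (simp add: field_simps del: power_Suc of_nat_Suc Stirling.simps)
  qed (simp)
qed

text \<open>The polynomial in z = - g_1 / hbar that represents hbar^(-k) phi_k / k!; the sign
  compensates the one in z (see \<open>phi_eq_g_poly\<close>).\<close>

definition stirling_poly :: "nat \<Rightarrow> complex poly" where
  "stirling_poly k =
    (\<Sum>j=1..k. monom (of_nat (fact (j - 1) * Stirling k j) / fact k * (- 1) ^ j) j)"

text \<open>The coefficient 1/j of the logarithm turns j! into (j-1)!. Here \<open>z\<close> is a
  number; identities of polynomials are recovered by varying it.\<close>

lemma stirling_poly_series: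
  "Abs_fps (\<lambda>k. poly (stirling_poly k) z) =
    - (fps_log_one_minus oo (fps_const (- z) * (fps_exp 1 - 1)))"
proof (rule fps_ext)
  fix k
  have "- (fps_nth fps_log_one_minus j * fps_nth ((fps_const (- z) * (fps_exp 1 - 1)) ^ j) k) =
      (if j = 0 then 0 else of_nat (fact (j - 1) * Stirling k j) / fact k * (- 1) ^ j * z ^ j)" for j
  proof (cases j)
    case (Suc i)
    have "fps_nth ((fps_const (- z) * (fps_exp 1 - 1)) ^ j) k =
        (- z) ^ j * (fact j * of_nat (Stirling k j) / fact k)"
      by (simp add: power_mult_distrib fps_nth_exp_minus_one_power)
    then show ?thesis
      using Suc by (simp add: fps_log_one_minus_def power_minus[of z] del: power_Suc of_nat_Suc)
  qed simp
  then have "fps_nth (- (fps_log_one_minus oo (fps_const (- z) * (fps_exp 1 - 1)))) k =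
      (\<Sum>j=0..k. if j = 0 then 0 else of_nat (fact (j - 1) * Stirling k j) / fact k * (- 1) ^ j * z ^ j)"
    by (simp add: fps_compose_nth flip: sum_negf)
  also have "\<dots> = poly (stirling_poly k) z"
    by (simp add: stirling_poly_def poly_sum poly_monom sum.atLeast_Suc_atMost[of 0])
  finally show "fps_nth (Abs_fps (\<lambda>k. poly (stirling_poly k) z)) k =
      fps_nth (- (fps_log_one_minus oo (fps_const (- z) * (fps_exp 1 - 1)))) k"
    by simp
qed

lemma fps_nth_log_monomial:
  assumes "N > 0"
  shows "fps_nth (fps_log_one_minus oo (fps_const c * fps_X ^ N)) n =
    (if n > 0 \<and> N dvd n then - (of_nat N / of_nat n * c ^ (n div N)) else 0)"
proof -
  have nth: "fps_nth ((fps_const c * fps_X ^ N) ^ i) n = (if n = N * i then c ^ i else 0)" for i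
    by (simp add: power_mult_distrib fps_X_power_nth flip: power_mult)
  show ?thesis
  proof (cases "N dvd n")
    case True
    then obtain q where q: "n = N * q" ..
    have "fps_nth (fps_log_one_minus oo (fps_const c * fps_X ^ N)) n =
        (\<Sum>i\<in>{q}. fps_nth fps_log_one_minus i * c ^ i)"
      unfolding fps_compose_nth nth
      by (rule sum.mono_neutral_cong_right) (use q assms in auto)
    then show ?thesis
      using q assms by (simp add: fps_log_one_minus_def)
  next
    case False
    then show ?thesis
      by (auto simp: fps_compose_nth nth intro!: sum.neutral)
  qed
qed

section \<open>Roots of unity and averages over rotations\<close>

lemma eps_power_eq_1_iff:
  assumes "M > 0"
  shows "eps M ^ n = 1 \<longleftrightarrow> M dvd n"
proof -
  have "eps M ^ n = exp (2 * of_real pi * \<i> * of_nat n / of_nat M)"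
    by (simp add: eps_def exp_of_nat_mult[symmetric] mult_ac)
  then show ?thesis
    using complex_root_unity_eq_1[of M n] assms by (simp add: Suc_le_eq)
qed

lemma norm_eps: "norm (eps M) = 1"
  by (simp add: eps_def norm_exp_eq_Re)

lemma sum_eps_powers:
  assumes "M > 0"
  shows "(\<Sum>m=1..M. (eps M ^ m) ^ n) = (if M dvd n then of_nat M else 0)"
proof -
  let ?w = "eps M ^ n"
  have "(\<Sum>m=1..M. (eps M ^ m) ^ n) = (\<Sum>m=1..M. ?w ^ m)"
    by (simp add: mult.commute flip: power_mult)
  also have "\<dots> = ?w * (\<Sum>m<M. ?w ^ m)"
    by (simp add: sum_distrib_left sum.atLeast1_atMost_eq)
  also have "\<dots> = (if M dvd n then of_nat M else 0)"
  proof (cases "M dvd n")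
    case True
    then have "?w = 1"
      using assms eps_power_eq_1_iff by blast
    then show ?thesis
      using True by simp
  next
    case False
    then have "?w \<noteq> 1"
      using assms eps_power_eq_1_iff by blast
    moreover have "?w ^ M = 1"
      using assms by (simp add: eps_power_eq_1_iff flip: power_mult)
    ultimately have "(\<Sum>m<M. ?w ^ m) = 0"
      by (simp add: geometric_sum)
    with False show ?thesis
      by simp
  qed
  finally show ?thesis .
qed

lemma sum_compose_rotations:
  assumes "M > 0"
  shows "(\<Sum>m=1..M. fps_nth (G oo (fps_const (eps M ^ m) * fps_X)) n) =
    (if M dvd n then of_nat M * fps_nth G n else 0)"
  using sum_eps_powers[OF assms, of n]
  by (simp add: fps_compose_linear flip: sum_distrib_right)

text \<open>Turns the factorization near 0 into an identity of formal series.\<close>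

lemma has_fps_expansion_unique:
  fixes f g :: "complex \<Rightarrow> complex"
  assumes "f has_fps_expansion F" "g has_fps_expansion G" "\<forall>\<^sub>F x in nhds 0. f x = g x"
  shows "F = G"
proof (rule fps_ext)
  fix n
  have "f has_fps_expansion G"
    using assms(2,3) unfolding has_fps_expansion_def by (auto elim: eventually_elim2)
  then show "fps_nth F n = fps_nth G n"
    using assms(1) by (simp add: fps_nth_fps_expansion)
qed

lemma has_fps_expansion_rotate:
  fixes \<alpha> :: "complex fps"
  assumes "fps_conv_radius \<alpha> > 0" "norm c = 1"
  shows "(\<lambda>x. eval_fps \<alpha> (c * x)) has_fps_expansion (\<alpha> oo (fps_const c * fps_X))"
proof (rule has_fps_expansionI)
  have "\<forall>\<^sub>F u in nhds 0. u \<in> eball 0 (fps_conv_radius \<alpha>)"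
    by (rule eventually_nhds_in_open) (use assms in \<open>auto simp flip: zero_ereal_def\<close>)
  then show "\<forall>\<^sub>F u in nhds 0. (\<lambda>n. fps_nth (\<alpha> oo (fps_const c * fps_X)) n * u ^ n) sums
      eval_fps \<alpha> (c * u)"
  proof eventually_elim
    case (elim u)
    then have "(\<lambda>n. fps_nth \<alpha> n * (c * u) ^ n) sums eval_fps \<alpha> (c * u)"
      using assms(2) by (intro sums_eval_fps) (simp add: norm_mult)
    then show ?case
      by (simp add: fps_compose_linear power_mult_distrib) (simp add: mult_ac)
  qed
qed

text \<open>
  Averaging over the rotations of \<open>X\<close> picks the coefficients whose index is divisible by the
  number of rotations; the same coefficients of \<open>Log (1 - \<alpha> z)\<close> thus serve for \<open>N\<close>
  rotations, where the hypothesis on \<open>\<alpha>\<close> applies, and for \<open>N L\<close> rotations.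
\<close>
lemma fps_nth_log_scaled:
  fixes \<alpha> :: "complex fps" and p :: "complex poly"
  assumes "N > 0" "fps_conv_radius \<alpha> > 0" "fps_nth \<alpha> 0 = 0"
    and fact: "\<forall>\<^sub>F x in nhds 0. 1 - x ^ N * poly p z =
      (\<Prod>m=1..N. 1 - eval_fps \<alpha> (eps N ^ m * x) * z)"
    and "n > 0" "N dvd n"
  shows "fps_nth (fps_log_one_minus oo (fps_const z * \<alpha>)) n = - (poly p z ^ (n div N) / of_nat n)"
proof -
  let ?b = "\<lambda>m. fps_const (eps N ^ m) * fps_X"
  let ?G = "fps_log_one_minus oo (fps_const z * \<alpha>)"
  have "(\<Prod>m=1..N. 1 - ((fps_const z * \<alpha>) oo ?b m)) = 1 - fps_const (poly p z) * fps_X ^ N"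
  proof (rule has_fps_expansion_unique)
    have "(\<lambda>x. \<Prod>m=1..N. 1 - z * eval_fps \<alpha> (eps N ^ m * x)) has_fps_expansion
        (\<Prod>m=1..N. 1 - fps_const z * (\<alpha> oo ?b m))"
      by (intro fps_expansion_intros has_fps_expansion_rotate assms)
        (simp add: norm_power norm_eps)
    moreover have "(fps_const z * \<alpha>) oo ?b m = fps_const z * (\<alpha> oo ?b m)" for m
      by (subst fps_compose_mult_distrib) simp_all
    ultimately show "(\<lambda>x. \<Prod>m=1..N. 1 - z * eval_fps \<alpha> (eps N ^ m * x)) has_fps_expansion
        (\<Prod>m=1..N. 1 - ((fps_const z * \<alpha>) oo ?b m))"
      by (simp only:)
    show "(\<lambda>x. 1 - poly p z * x ^ N) has_fps_expansion (1 - fps_const (poly p z) * fps_X ^ N)"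
      by (intro fps_expansion_intros)
    show "\<forall>\<^sub>F x in nhds 0. (\<Prod>m=1..N. 1 - z * eval_fps \<alpha> (eps N ^ m * x)) = 1 - poly p z * x ^ N"
      using fact by eventually_elim (simp add: mult_ac)
  qed
  \<comment> \<open>The logarithm of the product is a sum over the rotations of one series, whose
    coefficients the averaging isolates.\<close>
  then have "fps_log_one_minus oo (fps_const (poly p z) * fps_X ^ N) =
      (\<Sum>m=1..N. fps_log_one_minus oo ((fps_const z * \<alpha>) oo ?b m))"
    by (subst fps_log_prod[symmetric]) (simp_all add: assms)
  also have "\<dots> = (\<Sum>m=1..N. ?G oo ?b m)"
    by (simp add: fps_compose_assoc assms)
  finally have "fps_nth (fps_log_one_minus oo (fps_const (poly p z) * fps_X ^ N)) n =
      of_nat N * fps_nth ?G n"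
    using sum_compose_rotations[OF assms(1), of ?G n] assms by (simp add: fps_sum_nth)
  then have "of_nat N * fps_nth ?G n = of_nat N * - (poly p z ^ (n div N) / of_nat n)"
    using assms(1,5,6) by (simp add: fps_nth_log_monomial)
  then show ?thesis
    using assms(1) unfolding mult_cancel_left by simp
qed

text \<open>Polynomials in z are compared at every complex z, where the sum over all k is the
  rotation sum of - Log (1 - \<alpha> z). The shift by 2 reflects that the terms k = 0 and k = 1
  vanish.\<close>

lemma sum_stirling_poly_log_powers:
  fixes \<alpha> :: "complex fps" and p :: "complex poly" and N L :: nat
  defines "c \<equiv> \<lambda>k. \<Sum>m=1..N * L.
    (fps_log_one_minus oo (\<alpha> oo (fps_const (eps (N * L) ^ m) * fps_X))) ^ k"
  assumes "N > 0" "L > 0" "fps_conv_radius \<alpha> > 0" "fps_nth \<alpha> 0 = 0" "poly p 1 = 0"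
    and fact: "\<And>z. \<forall>\<^sub>F x in nhds 0. 1 - x ^ N * poly p z =
      (\<Prod>m=1..N. 1 - eval_fps \<alpha> (eps N ^ m * x) * z)"
  shows "(\<Sum>i\<le>n. smult (fps_nth (c (i + 2)) n) (stirling_poly (i + 2))) =
    (if n > 0 \<and> N * L dvd n then smult (of_nat (N * L) / of_nat n) (p ^ (n div N)) else 0)"
    (is "?lhs = ?rhs")
proof -
  let ?G = "\<lambda>z. fps_log_one_minus oo (fps_const z * \<alpha>)"
  let ?b = "\<lambda>m. fps_const (eps (N * L) ^ m) * fps_X"
  let ?u = "\<lambda>m. fps_log_one_minus oo (\<alpha> oo ?b m)"
  have NL: "N * L > 0"
    using assms by simp
  have sum_G: "(\<Sum>m=1..N * L. fps_nth (?G z oo ?b m) n) =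
      - (if n > 0 \<and> N * L dvd n then of_nat (N * L) / of_nat n * poly p z ^ (n div N) else 0)" for z
  proof -
    have "fps_nth (?G z) n = - (poly p z ^ (n div N) / of_nat n)" if "n > 0" "N * L dvd n"
      using that assms fact[of z] dvd_mult_left[of N L n] by (intro fps_nth_log_scaled) auto
    then show ?thesis
      unfolding sum_compose_rotations[OF NL] by (cases "n = 0") auto
  qed
  \<comment> \<open>The first power is the logarithm at z = 1, where \<open>p\<close> vanishes, and
    \<open>n div N\<close> is positive when \<open>N\<close> divides \<open>n > 0\<close>.\<close>
  have c1: "fps_nth (c 1) n = 0"
  proof -
    have "fps_nth (c 1) n = (\<Sum>m=1..N * L. fps_nth (?G 1 oo ?b m) n)"
      by (simp add: c_def fps_sum_nth fps_compose_assoc assms)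
    also have "\<dots> = 0"
      unfolding sum_G using assms dvd_mult_left[of N L n] by (auto simp: div_eq_0_iff dest: dvd_imp_le)
    finally show ?thesis .
  qed
  have cn: "fps_nth (c k) n = 0" if "n < k" for k
    unfolding c_def fps_sum_nth
    by (rule sum.neutral) (use that assms in \<open>auto intro!: startsby_zero_power_prefix[rule_format]\<close>)
  have "poly ?lhs z = poly ?rhs z" for z
  proof -
    let ?Q = "Abs_fps (\<lambda>k. poly (stirling_poly k) z)"
    \<comment> \<open>At u = Log (1 - \<alpha>), rotated, e^u - 1 becomes - \<alpha>.\<close>
    have comp: "?Q oo ?u m = - (?G z oo ?b m)" for m
    proof -
      have "?Q oo ?u m = - ((fps_log_one_minus oo (fps_const (- z) * (fps_exp 1 - 1))) oo ?u m)"
        by (simp add: stirling_poly_series fps_compose_uminus)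
      also have "\<dots> = - (fps_log_one_minus oo ((fps_const (- z) * (fps_exp 1 - 1)) oo ?u m))"
        by (subst fps_compose_assoc) (simp_all add: assms)
      also have "(fps_const (- z) * (fps_exp 1 - 1)) oo ?u m =
          fps_const (- z) * (((fps_exp 1 - 1) oo fps_log_one_minus) oo (\<alpha> oo ?b m))"
        by (subst fps_compose_mult_distrib) (simp_all add: assms fps_compose_assoc)
      also have "\<dots> = (fps_const z * \<alpha>) oo ?b m"
        by (simp add: exp_minus_one_compose_log fps_compose_uminus assms fps_compose_mult_distrib
            flip: fps_const_neg)
      finally show ?thesis
        by (simp add: fps_compose_assoc assms)
    qed
    have "poly ?rhs z = (\<Sum>m=1..N * L. fps_nth (?Q oo ?u m) n)"
      unfolding comp using sum_G[of z] by (simp add: sum_negf)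
    also have "\<dots> = (\<Sum>k=0..n. poly (stirling_poly k) z * fps_nth (c k) n)"
      by (simp add: fps_compose_nth c_def fps_sum_nth sum_distrib_left)
        (rule sum.swap)
    \<comment> \<open>Two vanishing terms are appended so that removing k = 0 and k = 1 leaves the
      range \<open>i \<le> n\<close>.\<close>
    also have "\<dots> = (\<Sum>k\<le>Suc (Suc n). poly (stirling_poly k) z * fps_nth (c k) n)"
      by (rule sum.mono_neutral_left) (auto simp: cn)
    also have "\<dots> = (\<Sum>i\<le>n. poly (stirling_poly (i + 2)) z * fps_nth (c (i + 2)) n)"
    proof -
      have "stirling_poly 0 = 0"
        by (simp add: stirling_poly_def)
      then show ?thesis
        using c1 by (simp add: sum.atMost_Suc_shift del: sum.atMost_Suc)
    qed
    also have "\<dots> = poly ?lhs z"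
      by (simp add: poly_sum mult.commute)
    finally show ?thesis ..
  qed
  then show ?thesis
    by (simp add: poly_eq_poly_eq_iff[symmetric] fun_eq_iff)
qed

subsection \<open>Polynomials without constant term inside the module of letters\<close>

text \<open>
  The image of a polynomial without constant term under \<open>z \<mapsto> - \<hbar>\<^sup>-\<^sup>1 g\<^sub>1\<close>, where the powers
  of \<open>g\<^sub>1\<close> are taken for \<^const>\<open>circ\<close>; constant terms are ignored.
\<close>
definition g_poly :: "complex poly \<Rightarrow> zmod" where
  "g_poly p = (\<Sum>j=1..degree p.
    lscale (laurent_const (coeff p j) * ((- 1) ^ j * hbar_pow (- int j))) (gen j))"

lemma lookup_g_poly:
  "Poly_Mapping.lookup (g_poly p) a = (case a of LetterE \<Rightarrow> 0
    | LetterG n \<Rightarrow> laurent_const (coeff p (Suc n)) * ((- 1) ^ Suc n * hbar_pow (- int (Suc n))))"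
proof (cases a)
  case (LetterG n)
  let ?c = "\<lambda>j. laurent_const (coeff p j) * ((- 1) ^ j * hbar_pow (- int j))"
  have "Poly_Mapping.lookup (g_poly p) a = (\<Sum>j=1..degree p. if j = Suc n then ?c j else 0)"
    unfolding g_poly_def lookup_sum
    by (rule sum.cong) (auto simp: lookup_lscale gen_def lookup_single LetterG when_def)
  also have "\<dots> = ?c (Suc n)"
    by (auto simp: coeff_eq_0 laurent_const_ring_hom)
  finally show ?thesis
    using LetterG by simp
qed (simp add: g_poly_def lookup_sum lookup_lscale gen_def lookup_single)

lemma g_poly_linear:
  "g_poly 0 = 0" "g_poly (p + q) = g_poly p + g_poly q"
  "g_poly (smult c p) = lscale (laurent_const c) (g_poly p)"
  by (rule poly_mapping_eqI; simp add: lookup_g_poly lookup_add lookup_lscale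
      laurent_const_ring_hom algebra_simps split: letter.split)+

lemma g_poly_sum: "g_poly (sum f S) = (\<Sum>i\<in>S. g_poly (f i))"
  by (induction S rule: infinite_finite_induct) (simp_all add: g_poly_linear)

lemma g_poly_monom:
  "g_poly (monom c (Suc n)) =
    Poly_Mapping.single (LetterG n) (laurent_const c * ((- 1) ^ Suc n * hbar_pow (- int (Suc n))))"
  by (rule poly_mapping_eqI)
    (auto simp: lookup_g_poly lookup_single when_def laurent_const_ring_hom split: letter.split)

lemma poly_induct_monom [case_names zero monom add]:
  assumes "P 0" "\<And>c n. P (monom c n)" "\<And>p q. P p \<Longrightarrow> P q \<Longrightarrow> P (p + q)"
  shows "P (p :: 'a::comm_monoid_add poly)"
proof -
  have "P (\<Sum>i\<in>S. monom (coeff p i) i)" if "finite S" for S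
    using that by induction (auto simp: assms)
  from this[of "{..degree p}"] show ?thesis
    by (simp add: poly_as_sum_of_monoms)
qed

text \<open>The shape \<open>pCons 0 p\<close> builds in the zero constant term, so induction over
  monomials needs no side condition; on monomials \<open>circ\<close> adds the indices of the
  g's.\<close>

lemma circ_g_poly_pCons:
  "circ (g_poly (pCons 0 p)) (g_poly (pCons 0 q)) = g_poly (pCons 0 p * pCons 0 q)"
proof (induction p rule: poly_induct_monom)
  case (monom c m)
  show ?case
  proof (induction q rule: poly_induct_monom)
    case (monom d n)
    have "hbar_pow (- int (Suc m)) * hbar_pow (- int (Suc n)) = hbar_pow (- int (Suc (Suc (m + n))))"
      by (simp flip: hbar_pow_add)
    then show ?case
      by (simp add: g_poly_monom circ_single mult_monom laurent_const_ring_hom power_add mult_ac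
          flip: monom_Suc)
  next
    case (add p q)
    moreover have "pCons 0 (p + q) = pCons 0 p + pCons 0 q"
      by simp
    ultimately show ?case
      by (simp only: circ_linear g_poly_linear distrib_left)
  qed (simp add: g_poly_linear circ_linear)
next
  case (add p r)
  moreover have "pCons 0 (p + r) = pCons 0 p + pCons 0 r"
    by simp
  ultimately show ?case
    by (simp only: circ_linear g_poly_linear distrib_right)
qed (simp add: g_poly_linear circ_linear)

lemma circ_g_poly:
  assumes "poly p 0 = 0" "poly q 0 = 0"
  shows "circ (g_poly p) (g_poly q) = g_poly (p * q)"
  using assms circ_g_poly_pCons by (cases p; cases q) simp

lemma circ_pow_g_poly:
  assumes "poly p 0 = 0" "n > 0"
  shows "circ_pow (g_poly p) n = g_poly (p ^ n)"
  using assms(2)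
proof (induction n rule: nat_induct_non_zero)
  case (Suc n)
  then obtain k where "n = Suc k"
    using gr0_conv_Suc by blast
  with Suc show ?case
    using circ_g_poly[of "p ^ Suc k" p] assms(1) by (simp add: mult.commute)
qed simp

lemma psi_eq_g_poly: "psi P = g_poly (map_poly of_rat P)"
  by (simp add: psi_def g_poly_def degree_map_poly coeff_map_poly)

lemma phi_eq_g_poly:
  "lscale (laurent_const (1 / fact k) * hbar_pow (- int k)) (phi k) = g_poly (stirling_poly k)"
  unfolding phi_def stirling_poly_def lscale_sum g_poly_sum lscale_lscale
proof (rule sum.cong)
  fix j assume j: "j \<in> {1..k}"
  then obtain i where i: "j = Suc i"
    by (cases j) auto
  have lc: "laurent_const (of_nat n) = of_nat n" for n
    by (induction n) (simp_all add: laurent_const_ring_hom)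
  have lcm: "laurent_const ((- 1) ^ n) = (- 1) ^ n" for n
    by (induction n) (simp_all add: laurent_const_ring_hom)
  have hbar: "hbar_pow (- int k) * hbar_pow (int (k - j)) = hbar_pow (- int j)"
    using j by (simp flip: hbar_pow_add add: of_nat_diff)
  have sgn: "(- 1) ^ j * ((- 1) ^ j * x) = x" for x :: laurent
    by (simp flip: mult.assoc power_mult_distrib)
  have coeff: "laurent_const (of_nat n / fact k * (- 1) ^ j) =
      laurent_const (1 / fact k) * (of_nat n * (- 1) ^ j)" for n
    by (simp flip: laurent_const_ring_hom(4) lc lcm)
  have eq: "laurent_const (of_nat n / fact k * (- 1) ^ j) * ((- 1) ^ j * hbar_pow (- int j)) =
      laurent_const (1 / fact k) * hbar_pow (- int k) * (of_nat n * hbar_pow (int (k - j)))" for n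
  proof -
    have "laurent_const (of_nat n / fact k * (- 1) ^ j) * ((- 1) ^ j * hbar_pow (- int j)) =
        laurent_const (1 / fact k) * (of_nat n * hbar_pow (- int j))"
      by (simp only: coeff mult.assoc sgn)
    then show ?thesis
      by (simp only: mult_ac flip: hbar)
  qed
  show "lscale (laurent_const (1 / fact k) * hbar_pow (- int k) *
        (of_nat (fact (j - 1) * Stirling k j) * hbar_pow (int (k - j)))) (gen j) =
      g_poly (monom (of_nat (fact (j - 1) * Stirling k j) / fact k * (- 1) ^ j) j)"
    unfolding eq[symmetric] unfolding i g_poly_monom by (simp add: gen_def)
qed simp

lemma poly_map_poly_of_rat:
  "poly (map_poly of_rat P) (of_rat x :: 'a::field_char_0) = of_rat (poly P x)"
  by (induction P) (simp_all add: map_poly_pCons of_rat_add of_rat_mult)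

text \<open>The case \<open>v = circ_pow (psi P) L\<close>, \<open>d = N * L\<close> of
  \<open>exp_harm_log\<close>, once the exponent is identified with \<open>log_coeff\<close>. The
  index \<open>i\<close> stands for k - 2.\<close>

theorem theorem3p1:
  fixes P :: "rat poly" and N L :: nat and \<alpha> :: "complex fps"
  assumes "P \<noteq> 0" and "poly P 0 = 0" and "poly P 1 = 0"
    and "N = degree P"
    and "L \<ge> 1"
    and "fps_conv_radius \<alpha> > 0"
    and "fps_nth \<alpha> 0 = 0"
    and "\<forall>\<^sub>F x in nhds (0::complex). \<forall>z::complex.
           1 - x ^ N * poly (map_poly of_rat P) z =
           (\<Prod>m=1..N. 1 - eval_fps \<alpha> (eps N ^ m * x) * z)"
  shows "recip_one_plus (fps_const (zmod_to_H1 (circ_pow (psi P) L)) * fps_X ^ (N * L)) =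
    exp_harm (- suminf (\<lambda>i. let k = i + 2 in
      fps_const (zmod_to_H1 (lscale (laurent_const (1 / fact k) * hbar_pow (- int k)) (phi k))) *
      fps_to_H1 (\<Sum>m=1..N * L.
        (fps_log_one_minus oo (\<alpha> oo (fps_const (eps (N * L) ^ m) * fps_X))) ^ k)))"
proof -
  define p :: "complex poly" where "p = map_poly of_rat P"
  define c where "c k = (\<Sum>m=1..N * L.
    (fps_log_one_minus oo (\<alpha> oo (fps_const (eps (N * L) ^ m) * fps_X))) ^ k)" for k
  \<comment> \<open>A constant \<open>P\<close> with P(0) = 0 would be zero.\<close>
  have N: "N > 0"
  proof (rule ccontr)
    assume "\<not> N > 0"
    then obtain a where "P = [:a:]"
      using assms(4) by (auto elim: degree_eq_zeroE)
    then show False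
      using assms(1,2) by simp
  qed
  have p0: "poly p 0 = 0" and p1: "poly p 1 = 0"
    using assms(2,3) poly_map_poly_of_rat[of P 0] poly_map_poly_of_rat[of P 1]
    by (simp_all add: p_def)
  \<comment> \<open>The logarithms have zero constant term, so their \<open>k\<close>-th powers
    start at X^k; the sum over k converges X-adically.\<close>
  have cn: "fps_nth (c k) n = 0" if "n < k" for k n
    unfolding c_def fps_sum_nth
    by (rule sum.neutral) (use that assms in \<open>auto intro!: startsby_zero_power_prefix[rule_format]\<close>)
  let ?s = "\<lambda>i. fps_const (zmod_to_H1 (g_poly (stirling_poly (i + 2)))) * fps_to_H1 (c (i + 2))"
  have s_nth: "fps_nth (?s i) n =
      zmod_to_H1 (g_poly (smult (fps_nth (c (i + 2)) n) (stirling_poly (i + 2))))" for i n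
    by (simp add: fps_mult_left_const_nth fps_to_H1_def g_poly_linear zmod_to_H1_linear
        flip: scalar_def scalar_mult) (simp add: scalar_central)
  have "- suminf ?s = letter_series (log_coeff (circ_pow (psi P) L) (N * L))"
  proof (rule fps_ext)
    fix n
    have "fps_nth (- suminf ?s) n = - (\<Sum>i\<le>n. fps_nth (?s i) n)"
      by (simp only: fps_neg_nth, subst fps_nth_suminf)
        (simp_all only: s_nth, simp add: cn g_poly_linear zmod_to_H1_linear)
    also have "\<dots> = - zmod_to_H1 (g_poly (\<Sum>i\<le>n. smult (fps_nth (c (i + 2)) n) (stirling_poly (i + 2))))"
      by (simp only: s_nth g_poly_sum zmod_to_H1_sum)
    also have "\<dots> = - zmod_to_H1 (g_poly (if n > 0 \<and> N * L dvd n
        then smult (of_nat (N * L) / of_nat n) (p ^ (n div N)) else 0))"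
      unfolding c_def
      by (subst sum_stirling_poly_log_powers)
        (use assms N p1 in \<open>auto simp: p_def elim: eventually_mono\<close>)
    also have "\<dots> = zmod_to_H1 (log_coeff (circ_pow (psi P) L) (N * L) n)"
    proof (cases "n > 0 \<and> N * L dvd n")
      case True
      then obtain q where q: "n = N * L * q" "q > 0"
        by (metis dvdE gr0I mult_0_right neq0_conv)
      \<comment> \<open>Here \<open>n div N = L * q\<close>, and iterated powers for
        \<open>circ\<close> are powers of polynomials.\<close>
      have "circ_pow (circ_pow (psi P) L) q = g_poly (p ^ (n div N))"
        using q N assms p0
        by (simp add: psi_eq_g_poly circ_pow_g_poly power_mult flip: p_def)
      then show ?thesis
        using True q N assms
        by (simp add: log_coeff_def g_poly_linear zmod_to_H1_linear scalar_ring_hom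
            flip: scalar_mult)
    qed (auto simp: log_coeff_def g_poly_linear zmod_to_H1_linear)
    finally show "fps_nth (- suminf ?s) n =
        fps_nth (letter_series (log_coeff (circ_pow (psi P) L) (N * L))) n"
      by (simp add: letter_series_def)
  qed
  then have "exp_harm (- suminf ?s) =
      recip_one_plus (fps_const (zmod_to_H1 (circ_pow (psi P) L)) * fps_X ^ (N * L))"
    using exp_harm_log[of "N * L"] N assms(5) by simp
  then show ?thesis
    by (simp only: Let_def phi_eq_g_poly flip: c_def)
qed

end
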